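(* Endow $\mathrm{DMC}_{\ast,\ast}^{(s)}$ with the strong topology $\mathcal{T}_{s,\ast,\ast}^{(s)}$. Then: (1) The capacity $C:\mathrm{DMC}_{\ast,\ast}^{(s)}\to\mathbb{R}^+$ is continuous on $(\mathrm{DMC}_{\ast,\ast}^{(s)},\mathcal{T}_{s,\ast,\ast}^{(s)})$. (2) For every $n\geq1$ and every $M\geq1$, the mapping $P_{e,n,M}:\mathrm{DMC}_{\ast,\ast}^{(s)}\to[0,1]$ is continuous on $(\mathrm{DMC}_{\ast,\ast}^{(s)},\mathcal{T}_{s,\ast,\ast}^{(s)})$.
   Context: For $n,m\ge1$ and $[n]=\{1,\dots,n\}$, $\mathrm{DMC}_{[n],[m]}$ is the set of channels from $[n]$ to $[m]$, i.e. families $W=(W(y|x))_{x\in[n],y\in[m]}$ of non-negative reals with $\sum_{y}W(y|x)=1$ for every $x$, with the topology $\mathcal{T}_{[n],[m]}$ inherited from $\mathbb{R}^{[n]\times[m]}$. Composition: $(V\circ W)(z|x)=\sum_yV(z|y)W(y|x)$. A channel $W'$ from $\mathcal{X}'$ to $\mathcal{Y}'$ contains a channel $W$ from $\mathcal{X}$ to $\mathcal{Y}$ if there exist $k\geq 1$, a probability distribution $\alpha$ on $[k]$, channels $R_i$ from $\mathcal{X}$ to $\mathcal{X}'$ and $T_i$ from $\mathcal{Y}'$ to $\mathcal{Y}$ ($1\le i\le k$) such that $W=\sum_{i=1}^k\alpha(i)\,T_i\circ W'\circ R_i$. Two channels are Shannon-equivalent if each contains the other. Let $\mathrm{DMC}_{\ast,\ast}=\coprod_{n,m\ge1}\mathrm{DMC}_{[n],[m]}$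 with the disjoint union topology $\mathcal{T}_{s,\ast,\ast}=\bigoplus_{n,m\ge1}\mathcal{T}_{[n],[m]}$, and let $\mathrm{DMC}_{\ast,\ast}^{(s)}$ be the quotient of $\mathrm{DMC}_{\ast,\ast}$ by Shannon-equivalence. The strong topology $\mathcal{T}_{s,\ast,\ast}^{(s)}$ is the quotient topology of $\mathcal{T}_{s,\ast,\ast}$. For a channel $W$ from $\mathcal{X}$ to $\mathcal{Y}$, $C(W)$ is its Shannon capacity (the maximum over input distributions on $\mathcal{X}$ of the mutual information between input and output, in nats). An $(n,M)$-encoder on $\mathcal{X}$ is a map $\mathcal{E}:\mathcal{M}\to\mathcal{X}^n$ with $|\mathcal{M}|=M$, $\mathcal{E}(m)=(\mathcal{E}_1(m),\dots,\mathcal{E}_n(m))$; its ML error probability is $P_{e,\mathcal{E}}(W)=1-\frac1M\sum_{y_1^n\in\mathcal{Y}^n}\max_{m\in\mathcal{M}}\prod_{i=1}^nW(y_i|\mathcal{E}_i(m))$, and $P_{e,n,M}(W)=\min_{\mathcal{E}}P_{e,\mathcal{E}}(W)$ over all $(n,M)$-encoders $\mathcal{E}$ on $\mathcal{X}$. It is known (Shannon) that $C(W)$ and $P_{e,n,M}(W)$ depend only on the Shannon-equivalence class of $W$; $C(\hat W)$ and $P_{e,n,M}(\hat W)$ denote their common values on a class $\hat W$. $\mathbb{R}^+$ is the set of non-negative reals. *)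

theory Defs
  imports "HOL-Probability.Probability"
begin

section \<open>Channels between finite alphabets\<close>

text \<open>
  The alphabet \<open>[n]\<close> is \<open>{1..n}\<close>. The transition probability \<open>W(y|x)\<close> is written \<open>W (x, y)\<close>, so the
  input comes first. Families are extensional (\<open>undefined\<close> off their index set), so that
  equality of HOL functions is equality of families.
\<close>

definition prob_dists :: "nat \<Rightarrow> (nat \<Rightarrow> real) set" where
  "prob_dists n = {p \<in> {1..n} \<rightarrow>\<^sub>E UNIV. (\<forall>x\<in>{1..n}. 0 \<le> p x) \<and> (\<Sum>x=1..n. p x) = 1}"

definition DMC :: "nat \<Rightarrow> nat \<Rightarrow> (nat \<times> nat \<Rightarrow> real) set" where
  "DMC n m = {W \<in> {1..n} \<times> {1..m} \<rightarrow>\<^sub>E UNIV.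
     (\<forall>x\<in>{1..n}. \<forall>y\<in>{1..m}. 0 \<le> W (x, y)) \<and> (\<forall>x\<in>{1..n}. (\<Sum>y=1..m. W (x, y)) = 1)}"

definition DMC_topology :: "nat \<Rightarrow> nat \<Rightarrow> (nat \<times> nat \<Rightarrow> real) topology" where
  "DMC_topology n m =
     subtopology (product_topology (\<lambda>_. euclideanreal) ({1..n} \<times> {1..m})) (DMC n m)"

text \<open>
  \<open>channel_comp n m l V W\<close> is \<open>V \<circ> W\<close> for \<open>W\<close> from \<open>[n]\<close> to \<open>[m]\<close> and \<open>V\<close> from \<open>[m]\<close> to \<open>[l]\<close>.
\<close>

definition channel_comp ::
    "nat \<Rightarrow> nat \<Rightarrow> nat \<Rightarrow> (nat \<times> nat \<Rightarrow> real) \<Rightarrow> (nat \<times> nat \<Rightarrow> real) \<Rightarrow> nat \<times> nat \<Rightarrow> real" where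
  "channel_comp n m l V W = (\<lambda>(x, z)\<in>{1..n} \<times> {1..l}. \<Sum>y=1..m. V (y, z) * W (x, y))"

text \<open>A point of the disjoint union over all \<open>n, m \<ge> 1\<close> is a channel tagged with its alphabet sizes.\<close>

type_synonym channel = "(nat \<times> nat) \<times> (nat \<times> nat \<Rightarrow> real)"

fun channel_contains :: "channel \<Rightarrow> channel \<Rightarrow> bool" where
  "channel_contains ((n', m'), W') ((n, m), W) \<longleftrightarrow>
     (\<exists>k\<ge>1. \<exists>\<alpha>\<in>prob_dists k. \<exists>R T.
        (\<forall>i\<in>{1..k}. R i \<in> DMC n n' \<and> T i \<in> DMC m' m) \<and>
        (\<forall>x\<in>{1..n}. \<forall>y\<in>{1..m}. W (x, y) =
           (\<Sum>i=1..k. \<alpha> i * channel_comp n m' m (T i) (channel_comp n n' m' W' (R i)) (x, y))))"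

definition DMC_all_topology :: "channel topology" where
  "DMC_all_topology = sum_topology (\<lambda>(n, m). DMC_topology n m) ({1..} \<times> {1..})"

definition shannon_equiv :: "(channel \<times> channel) set" where
  "shannon_equiv = {(W, W'). W \<in> topspace DMC_all_topology \<and> W' \<in> topspace DMC_all_topology \<and>
     channel_contains W W' \<and> channel_contains W' W}"


section \<open>Quotient topology and the strong topology\<close>

definition quotient_topology :: "'a topology \<Rightarrow> ('a \<times> 'a) set \<Rightarrow> 'a set topology" where
  "quotient_topology X r =
     topology (\<lambda>U. U \<subseteq> topspace X // r \<and> openin X {x \<in> topspace X. r `` {x} \<in> U})"

lemma openin_quotient_topology:
  "openin (quotient_topology X r) U \<longleftrightarrow>
     U \<subseteq> topspace X // r \<and> openin X {x \<in> topspace X. r `` {x} \<in> U}"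
proof -
  have "istopology (\<lambda>U. U \<subseteq> topspace X // r \<and> openin X {x \<in> topspace X. r `` {x} \<in> U})"
  proof -
    have 1: "{x \<in> topspace X. r `` {x} \<in> S \<inter> T} =
        {x \<in> topspace X. r `` {x} \<in> S} \<inter> {x \<in> topspace X. r `` {x} \<in> T}" for S T
      by auto
    have 2: "{x \<in> topspace X. r `` {x} \<in> \<Union>K} =
        (\<Union>S\<in>K. {x \<in> topspace X. r `` {x} \<in> S})" for K
      by auto
    show ?thesis
      unfolding istopology_def 1 2 by blast
  qed
  then show ?thesis
    by (simp add: quotient_topology_def)
qed

lemma topspace_quotient_topology [simp]: "topspace (quotient_topology X r) = topspace X // r"
proof
  show "topspace (quotient_topology X r) \<subseteq> topspace X // r"
    using openin_quotient_topology[of X r "topspace (quotient_topology X r)"] by simp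
  have "{x \<in> topspace X. r `` {x} \<in> topspace X // r} = topspace X"
    by (auto intro: quotientI)
  then show "topspace X // r \<subseteq> topspace (quotient_topology X r)"
    by (intro openin_subset) (simp add: openin_quotient_topology)
qed

lemma quotient_map_quotient_topology:
  "quotient_map X (quotient_topology X r) (\<lambda>x. r `` {x})"
  unfolding quotient_map_def by (auto simp: openin_quotient_topology quotient_def)

definition strong_topology :: "channel set topology" where
  "strong_topology = quotient_topology DMC_all_topology shannon_equiv"


section \<open>Capacity\<close>

text \<open>The joint law of input and output for input distribution \<open>p\<close>, as a measure on \<open>[n] \<times> [m]\<close>.\<close>

definition joint_law :: "nat \<Rightarrow> nat \<Rightarrow> (nat \<Rightarrow> real) \<Rightarrow> (nat \<times> nat \<Rightarrow> real) \<Rightarrow> (nat \<times> nat) measure" where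
  "joint_law n m p W = point_measure ({1..n} \<times> {1..m}) (\<lambda>(x, y). ennreal (p x * W (x, y)))"

text \<open>Base \<open>exp 1\<close> gives mutual information in nats.\<close>

definition channel_information :: "nat \<Rightarrow> nat \<Rightarrow> (nat \<Rightarrow> real) \<Rightarrow> (nat \<times> nat \<Rightarrow> real) \<Rightarrow> real" where
  "channel_information n m p W =
     prob_space.mutual_information (joint_law n m p W) (exp 1)
       (count_space {1..n}) (count_space {1..m}) fst snd"

lemma channel_information_eq:
  assumes p: "p \<in> prob_dists n" and W: "W \<in> DMC n m"
  shows "channel_information n m p W =
    (\<Sum>x=1..n. \<Sum>y=1..m. p x * W (x, y) * ln (p x * W (x, y) / (p x * (\<Sum>x'=1..n. p x' * W (x', y)))))"
proof -
  let ?M = "joint_law n m p W"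
  have nn: "0 \<le> p x * W (x,y)" if "x \<in> {1..n}" "y \<in> {1..m}" for x y
    using p W that by (auto simp: prob_dists_def DMC_def)
  have rows: "(\<Sum>y=1..m. p x * W (x, y)) = p x" if "x \<in> {1..n}" for x
    using W that by (simp add: DMC_def flip: sum_distrib_left)
  have tot: "(\<Sum>(x,y)\<in>{1..n}\<times>{1..m}. p x * W (x,y)) = 1"
    using p rows by (simp add: prob_dists_def flip: sum.cartesian_product)
  have "(\<Sum>z\<in>{1..n}\<times>{1..m}. case z of (x,y) \<Rightarrow> ennreal (p x * W (x,y))) = (\<Sum>z\<in>{1..n}\<times>{1..m}. ennreal (case z of (x,y) \<Rightarrow> p x * W (x,y)))"
    by (intro sum.cong) auto
  also have "\<dots> = ennreal (\<Sum>z\<in>{1..n}\<times>{1..m}. case z of (x,y) \<Rightarrow> p x * W (x,y))"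
    using nn by (intro sum_ennreal) auto
  finally have "(\<Sum>z\<in>{1..n}\<times>{1..m}. case z of (x,y) \<Rightarrow> ennreal (p x * W (x,y))) = 1"
    using tot by simp
  then have "prob_space ?M"
    unfolding joint_law_def
    by (intro prob_spaceI) (simp only: space_point_measure emeasure_point_measure_finite subset_refl finite_cartesian_product finite_atLeastAtMost)
  then interpret information_space ?M "exp 1"
    by (simp add: information_space_def information_space_axioms_def)
  define P where "P = (\<lambda>(x,y). p x * W (x,y))"
  define q where "q = (\<lambda>y. \<Sum>x'=1..n. p x' * W (x', y))"
  have pp: "count_space {1..n} \<Otimes>\<^sub>M count_space {1..m} = count_space ({1..n} \<times> {1..m})"
    by (simp add: pair_measure_count_space)
  have em: "emeasure ?M A = (\<Sum>z\<in>A. ennreal (P z))" if "A \<subseteq> {1..n}\<times>{1..m}" for A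
    using that unfolding joint_law_def P_def
    by (subst emeasure_point_measure_finite) (auto simp: case_prod_unfold)
  have sp: "space ?M = {1..n}\<times>{1..m}" by (simp add: joint_law_def space_point_measure)
  have mf: "fst \<in> measurable ?M (count_space {1..n})" "snd \<in> measurable ?M (count_space {1..m})"
    by (auto simp: joint_law_def)
  have "channel_information n m p W = integral\<^sup>L (count_space {1..n} \<Otimes>\<^sub>M count_space {1..m})
     (\<lambda>z. P z * log (exp 1) (P z / (p (fst z) * q (snd z))))"
    unfolding channel_information_def
  proof (rule mutual_information_distr)
    show "distributed ?M (count_space {1..n}) fst p"
      unfolding distributed_def
    proof (intro conjI)
      show "distr ?M (count_space {1..n}) fst = density (count_space {1..n}) (\<lambda>x. ennreal (p x))"
      proof (rule measure_eqI_countable[where A="{1..n}"])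
        fix a assume a: "a \<in> {1..n}"
        have "fst -` {a} \<inter> space ?M = {a}\<times>{1..m}" using a sp by auto
        then have "emeasure (distr ?M (count_space {1..n}) fst) {a} = (\<Sum>z\<in>{a}\<times>{1..m}. ennreal (P z))"
          using a em[of "{a}\<times>{1..m}", OF Sigma_mono] by (subst emeasure_distr[OF mf(1)]) (auto simp del: One_nat_def simp: subset_iff)
        also have "\<dots> = ennreal (\<Sum>z\<in>{a}\<times>{1..m}. P z)"
          using nn a by (intro sum_ennreal) (auto simp: P_def)
        also have "(\<Sum>z\<in>{a}\<times>{1..m}. P z) = p a"
          using rows[OF a] by (simp add: P_def flip: sum.cartesian_product)
        finally show "emeasure (distr ?M (count_space {1..n}) fst) {a} = emeasure (density (count_space {1..n}) (\<lambda>x. ennreal (p x))) {a}"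
          using a by (simp add: emeasure_density nn_integral_count_space_finite indicator_def)
      qed (auto)
    qed (auto simp: joint_law_def)
    show "distributed ?M (count_space {1..m}) snd q"
      unfolding distributed_def
    proof (intro conjI)
      show "distr ?M (count_space {1..m}) snd = density (count_space {1..m}) (\<lambda>x. ennreal (q x))"
      proof (rule measure_eqI_countable[where A="{1..m}"])
        fix a assume a: "a \<in> {1..m}"
        have "snd -` {a} \<inter> space ?M = {1..n}\<times>{a}" using a sp by auto
        then have "emeasure (distr ?M (count_space {1..m}) snd) {a} = (\<Sum>z\<in>{1..n}\<times>{a}. ennreal (P z))"
          using a em[of "{1..n}\<times>{a}", OF Sigma_mono] by (subst emeasure_distr[OF mf(2)]) (auto simp del: One_nat_def simp: subset_iff)
        also have "\<dots> = ennreal (\<Sum>z\<in>{1..n}\<times>{a}. P z)"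
          using nn a by (intro sum_ennreal) (auto simp: P_def)
        also have "(\<Sum>z\<in>{1..n}\<times>{a}. P z) = q a"
          by (simp add: P_def q_def flip: sum.cartesian_product)
        finally show "emeasure (distr ?M (count_space {1..m}) snd) {a} = emeasure (density (count_space {1..m}) (\<lambda>x. ennreal (q x))) {a}"
          using a by (simp add: emeasure_density nn_integral_count_space_finite indicator_def)
      qed (auto)
    qed (auto simp: joint_law_def)
    show "distributed ?M (count_space {1..n} \<Otimes>\<^sub>M count_space {1..m}) (\<lambda>x. (fst x, snd x)) P"
      unfolding distributed_def pp joint_law_def point_measure_def
      by (auto simp: P_def case_prod_unfold distr_id2)
  qed (use p nn in \<open>auto simp: sigma_finite_measure_count_space_finite prob_dists_def q_def P_def space_pair_measure intro!: sum_nonneg\<close>)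
  also have "\<dots> = (\<Sum>z\<in>{1..n}\<times>{1..m}. P z * log (exp 1) (P z / (p (fst z) * q (snd z))))"
    unfolding pp by (subst lebesgue_integral_count_space_finite) auto
  also have "\<dots> = (\<Sum>x=1..n. \<Sum>y=1..m. P (x,y) * ln (P (x,y) / (p x * q y)))"
    by (simp add: sum.cartesian_product case_prod_unfold log_def)
  finally show ?thesis by (simp add: P_def q_def)
qed

fun capacity :: "channel \<Rightarrow> real" where
  "capacity ((n, m), W) = (GREATEST c. c \<in> (\<lambda>p. channel_information n m p W) ` prob_dists n)"


section \<open>Maximum-likelihood error probability\<close>

text \<open>
  Only the size of the message set matters for the error probability, so it is taken to be \<open>[M]\<close>.
  In \<open>encoders a n M\<close>, \<open>a\<close> is the size of the input alphabet and \<open>n\<close> the blocklength.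
\<close>

definition encoders :: "nat \<Rightarrow> nat \<Rightarrow> nat \<Rightarrow> (nat \<Rightarrow> nat \<Rightarrow> nat) set" where
  "encoders a n M = {1..M} \<rightarrow>\<^sub>E ({1..n} \<rightarrow>\<^sub>E {1..a})"

definition encoder_error ::
    "nat \<Rightarrow> nat \<Rightarrow> nat \<Rightarrow> (nat \<Rightarrow> nat \<Rightarrow> nat) \<Rightarrow> (nat \<times> nat \<Rightarrow> real) \<Rightarrow> real" where
  "encoder_error b n M E W =
     1 - 1 / real M *
       (\<Sum>y\<in>{1..n} \<rightarrow>\<^sub>E {1..b}. MAX msg\<in>{1..M}. \<Prod>i=1..n. W (E msg i, y i))"

fun error_prob :: "nat \<Rightarrow> nat \<Rightarrow> channel \<Rightarrow> real" where
  "error_prob n M ((a, b), W) = (MIN E\<in>encoders a n M. encoder_error b n M E W)"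


section \<open>Passage to equivalence classes\<close>

text \<open>\<open>the_elem\<close> picks the common value; it is unspecified unless the value is constant on the class.\<close>

definition class_value :: "(channel \<Rightarrow> real) \<Rightarrow> channel set \<Rightarrow> real" where
  "class_value f K = the_elem (f ` K)"

end

theory Submission
  imports Defs "HOL-Real_Asymp.Real_Asymp"
begin

text \<open>
  A function on channels that is monotone under containment is constant on Shannon-equivalence
  classes, and its quotient is continuous as soon as the function is continuous on each \<open>DMC n m\<close>.

  For the error probability, an \<open>n\<close>-fold use of \<open>\<Sum>\<^sub>i \<alpha>\<^sub>i (T\<^sub>i \<circ> W' \<circ> R\<^sub>i)\<close> is a mixture, over index sequences, of
  uses of \<open>W'\<close> with a randomised encoder and decoder, which never beat the best deterministic
  encoder with maximum-likelihood decoding. Continuity is clear: only finite sums, products, maxima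
  and minima occur.

  For the capacity, monotonicity comes from the log-sum inequality. The information is jointly
  continuous in input distribution and channel, hence uniformly continuous by compactness, and so
  its maximum over input distributions is continuous in the channel.
\<close>

section \<open>Descending to the quotient\<close>

text \<open>Bridges two topologies: \<open>DMC_topology\<close> is a product over the index set
  alone, while \<open>continuous_on\<close> refers to the product over all of
  \<open>nat \<times> nat\<close>. The inclusion is continuous because a coordinate off the index
  set is constantly \<open>undefined\<close>.\<close>

lemma continuous_map_DMC:
  assumes "continuous_on (DMC n m) f"
  shows "continuous_map (DMC_topology n m) euclideanreal f"
proof -
  have "continuous_map (DMC_topology n m) (top_of_set (DMC n m)) (\<lambda>W. W)"
    unfolding continuous_map_in_subtopology
  proof (intro conjI)
    have "continuous_map (DMC_topology n m) euclideanreal (\<lambda>W. W z)" for z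
    proof (cases "z \<in> {1..n} \<times> {1..m}")
      case True
      then show ?thesis
        unfolding DMC_topology_def
        by (intro continuous_map_from_subtopology continuous_map_product_projection)
    next
      case False
      have "continuous_map (DMC_topology n m) euclideanreal (\<lambda>W. undefined)"
        by simp
      then show ?thesis
      proof (rule continuous_map_eq)
        fix W assume "W \<in> topspace (DMC_topology n m)"
        then have "W \<in> {1..n} \<times> {1..m} \<rightarrow>\<^sub>E UNIV"
          by (simp add: DMC_topology_def DMC_def)
        from PiE_arb[OF this False] show "undefined = W z" by simp
      qed
    qed
    then have "continuous_map (DMC_topology n m) (product_topology (\<lambda>_. euclideanreal) UNIV) (\<lambda>W. W)"
      by (intro continuous_map_coordinatewise_then_product) auto
    then show "continuous_map (DMC_topology n m) euclidean (\<lambda>W. W)"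
      by (simp add: euclidean_product_topology)
  qed (auto simp: DMC_topology_def)
  from continuous_map_compose[OF this, of euclideanreal f] assms show ?thesis
    by (simp add: o_def)
qed

lemma topspace_DMC_topology: "topspace (DMC_topology n m) = DMC n m"
  by (auto simp: DMC_topology_def DMC_def)

lemma mem_topspace_DMC_all:
  "((n, m), W) \<in> topspace DMC_all_topology \<longleftrightarrow> n \<ge> 1 \<and> m \<ge> 1 \<and> W \<in> DMC n m"
  by (auto simp: DMC_all_topology_def topspace_DMC_topology)

section \<open>Reflexivity of containment\<close>

definition id_channel :: "nat \<Rightarrow> nat \<times> nat \<Rightarrow> real" where
  "id_channel n = (\<lambda>(x, y)\<in>{1..n} \<times> {1..n}. if x = y then 1 else 0)"

lemma id_channel_DMC: "id_channel n \<in> DMC n n"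
  by (auto simp: id_channel_def DMC_def)

lemma channel_comp_id_right:
  assumes "x \<in> {1..n}" "y \<in> {1..m}"
  shows "channel_comp n n m W (id_channel n) (x, y) = W (x, y)"
proof -
  have "(\<Sum>x'=1..n. W (x', y) * id_channel n (x, x')) = (\<Sum>x'=1..n. if x = x' then W (x', y) else 0)"
    using assms by (intro sum.cong) (auto simp: id_channel_def)
  then show ?thesis
    using assms by (simp add: channel_comp_def)
qed

lemma channel_comp_id_left:
  assumes "x \<in> {1..n}" "y \<in> {1..m}"
  shows "channel_comp n m m (id_channel m) V (x, y) = V (x, y)"
proof -
  have "(\<Sum>y'=1..m. id_channel m (y', y) * V (x, y')) = (\<Sum>y'=1..m. if y' = y then V (x, y') else 0)"
    using assms by (intro sum.cong) (auto simp: id_channel_def)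
  then show ?thesis
    using assms by (simp add: channel_comp_def)
qed

text \<open>Take \<open>k = 1\<close> and identity channels on both sides. Reflexivity puts each
  channel into its own class, which is what allows a value to be read off the class.\<close>

lemma channel_contains_refl: "channel_contains ((n, m), W) ((n, m), W)"
  unfolding channel_contains.simps
proof (intro exI conjI bexI)
  let ?\<alpha> = "\<lambda>i\<in>{1..1::nat}. 1::real"
  show "?\<alpha> \<in> prob_dists 1"
    by (auto simp: prob_dists_def)
  show "\<forall>i\<in>{1..1}. id_channel n \<in> DMC n n \<and> id_channel m \<in> DMC m m"
    by (simp add: id_channel_DMC)
  show "\<forall>x\<in>{1..n}. \<forall>y\<in>{1..m}. W (x, y) = (\<Sum>i=1..1. ?\<alpha> i *
      channel_comp n m m (id_channel m) (channel_comp n n m W (id_channel n)) (x, y))"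
    by (simp add: channel_comp_id_left channel_comp_id_right del: One_nat_def)
qed simp

section \<open>Universal property of the quotient\<close>

text \<open>Continuity on a disjoint union is tested on the summands, and
  \<open>class_value f\<close> after the projection is \<open>f\<close> itself, so the universal
  property of the quotient map applies.\<close>

lemma continuous_map_strong_topology:
  assumes inv: "\<And>W W'. (W, W') \<in> shannon_equiv \<Longrightarrow> f W = f W'"
    and cont: "\<And>n m. n \<ge> 1 \<Longrightarrow> m \<ge> 1 \<Longrightarrow> continuous_on (DMC n m) (\<lambda>W. f ((n, m), W))"
    and range: "\<And>n m W. n \<ge> 1 \<Longrightarrow> m \<ge> 1 \<Longrightarrow> W \<in> DMC n m \<Longrightarrow> f ((n, m), W) \<in> S"
  shows "continuous_map strong_topology (top_of_set S) (class_value f)"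
proof -
  have "continuous_map DMC_all_topology euclideanreal f"
  proof -
    have "openin DMC_all_topology {x \<in> topspace DMC_all_topology. f x \<in> U}" if U: "open U" for U
      unfolding DMC_all_topology_def openin_sum_topology
    proof (intro conjI ballI)
      fix i :: "nat \<times> nat" assume i: "i \<in> {1..} \<times> {1..}"
      obtain n m where nm: "i = (n, m)" by force
      have "continuous_map (DMC_topology n m) euclideanreal (\<lambda>W. f ((n, m), W))"
        using i nm by (intro continuous_map_DMC cont) auto
      then have "openin (DMC_topology n m) {W \<in> topspace (DMC_topology n m). f ((n, m), W) \<in> U}"
        using U openin_continuous_map_preimage open_openin by blast
      moreover have "{x. (i, x) \<in> {x \<in> topspace (sum_topology (\<lambda>(n, m). DMC_topology n m) ({1..} \<times> {1..})). f x \<in> U}}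
          = {W \<in> topspace (DMC_topology n m). f ((n, m), W) \<in> U}"
        using i nm by auto
      ultimately show "openin (case i of (n, m) \<Rightarrow> DMC_topology n m) {x. (i, x) \<in>
          {x \<in> topspace (sum_topology (\<lambda>(n, m). DMC_topology n m) ({1..} \<times> {1..})). f x \<in> U}}"
        using nm by simp
    qed auto
    then show ?thesis
      by (auto simp: continuous_map_def open_openin[symmetric])
  qed
  moreover have "f x \<in> S" if "x \<in> topspace DMC_all_topology" for x
    using that range by (cases x) (auto simp: mem_topspace_DMC_all)
  ultimately have f: "continuous_map DMC_all_topology (top_of_set S) f"
    by (auto simp: continuous_map_in_subtopology)
  \<comment> \<open>The image of the class under \<open>f\<close> is a singleton, so
    \<open>the_elem\<close> has its intended value.\<close>
  have class_value_eq: "class_value f (shannon_equiv `` {W}) = f W" if "W \<in> topspace DMC_all_topology" for W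
  proof -
    have "W \<in> shannon_equiv `` {W}"
      using that channel_contains_refl by (cases W) (auto simp: shannon_equiv_def)
    moreover have "f W' = f W" if "W' \<in> shannon_equiv `` {W}" for W'
      using inv[of W W'] that by simp
    ultimately have "f ` (shannon_equiv `` {W}) = {f W}"
      by blast
    then show ?thesis
      by (simp add: class_value_def)
  qed
  from f have "continuous_map DMC_all_topology (top_of_set S) (class_value f \<circ> (\<lambda>W. shannon_equiv `` {W}))"
    by (rule continuous_map_eq) (simp add: class_value_eq)
  then show ?thesis
    unfolding strong_topology_def
    using continuous_compose_quotient_map_eq[OF quotient_map_quotient_topology] by blast
qed

section \<open>Distributions, channels and containment in coordinates\<close>

lemma prob_dists_nonneg: "p \<in> prob_dists n \<Longrightarrow> x \<in> {1..n} \<Longrightarrow> 0 \<le> p x"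
  by (simp add: prob_dists_def)

lemma prob_dists_sum: "p \<in> prob_dists n \<Longrightarrow> sum p {1..n} = 1"
  by (simp add: prob_dists_def)

lemma DMC_nonneg: "W \<in> DMC n m \<Longrightarrow> x \<in> {1..n} \<Longrightarrow> y \<in> {1..m} \<Longrightarrow> 0 \<le> W (x, y)"
  by (simp add: DMC_def)

lemma DMC_sum: "W \<in> DMC n m \<Longrightarrow> x \<in> {1..n} \<Longrightarrow> (\<Sum>y=1..m. W (x, y)) = 1"
  by (simp add: DMC_def)

lemma channel_containsE:
  assumes "channel_contains ((n', m'), W') ((n, m), W)"
  obtains k \<alpha> R T where "\<alpha> \<in> prob_dists k"
    "\<And>i. i \<in> {1..k} \<Longrightarrow> R i \<in> DMC n n'" "\<And>i. i \<in> {1..k} \<Longrightarrow> T i \<in> DMC m' m"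
    "\<And>x y. x \<in> {1..n} \<Longrightarrow> y \<in> {1..m} \<Longrightarrow> W (x, y) =
       (\<Sum>i=1..k. \<alpha> i * (\<Sum>y'=1..m'. T i (y', y) * (\<Sum>x'=1..n'. R i (x, x') * W' (x', y'))))"
proof -
  from assms obtain k \<alpha> R T where *: "\<alpha> \<in> prob_dists k"
    "\<forall>i\<in>{1..k}. R i \<in> DMC n n' \<and> T i \<in> DMC m' m"
    "\<forall>x\<in>{1..n}. \<forall>y\<in>{1..m}. W (x, y) =
      (\<Sum>i=1..k. \<alpha> i * channel_comp n m' m (T i) (channel_comp n n' m' W' (R i)) (x, y))"
    unfolding channel_contains.simps by blast
  show thesis
  proof (rule that)
    show "\<alpha> \<in> prob_dists k" by (fact *(1))
    show "R i \<in> DMC n n'" "T i \<in> DMC m' m" if "i \<in> {1..k}" for i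
      using *(2) that by auto
    fix x y assume xy: "x \<in> {1..n}" "y \<in> {1..m}"
    show "W (x, y) =
       (\<Sum>i=1..k. \<alpha> i * (\<Sum>y'=1..m'. T i (y', y) * (\<Sum>x'=1..n'. R i (x, x') * W' (x', y'))))"
      unfolding *(3)[rule_format, OF xy] using xy
      by (intro sum.cong refl) (auto simp: channel_comp_def mult.commute intro!: sum.cong)
  qed
qed


section \<open>Error probability\<close>

text \<open>The right-hand side is the value of the random encoder that draws the codeword of
  each message \<open>m\<close> independently from \<open>q m\<close>.\<close>

lemma Max_expectation_le:
  fixes q :: "'m \<Rightarrow> 'x \<Rightarrow> real"
  assumes fin: "finite A" "A \<noteq> {}" "finite X"
    and q: "\<And>m x. m \<in> A \<Longrightarrow> x \<in> X \<Longrightarrow> 0 \<le> q m x" "\<And>m. m \<in> A \<Longrightarrow> (\<Sum>x\<in>X. q m x) = 1"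
  shows "(MAX m\<in>A. \<Sum>x\<in>X. q m x * h x) \<le>
    (\<Sum>g\<in>A \<rightarrow>\<^sub>E X. (\<Prod>m\<in>A. q m (g m)) * (MAX m\<in>A. h (g m)))"
proof (rule Max.boundedI)
  fix v assume "v \<in> (\<lambda>m. \<Sum>x\<in>X. q m x * h x) ` A"
  then obtain m0 where m0: "m0 \<in> A" "v = (\<Sum>x\<in>X. q m0 x * h x)" by auto
  \<comment> \<open>The factor \<open>h\<close> is switched on only for the message
    \<open>m0\<close>; every other factor is a total mass 1. The expectation thus becomes a product
    over all messages, which expands into a sum over encoders \<open>g\<close>.\<close>
  define c where "c m x = (if m = m0 then h x else 1)" for m x
  have "(\<Prod>m\<in>A. \<Sum>x\<in>X. q m x * c m x) = (\<Prod>m\<in>A. if m = m0 then v else 1)"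
    using q(2) m0 by (intro prod.cong) (auto simp: c_def)
  then have "v = (\<Prod>m\<in>A. \<Sum>x\<in>X. q m x * c m x)"
    using m0 fin by simp
  also have "\<dots> = (\<Sum>g\<in>A \<rightarrow>\<^sub>E X. \<Prod>m\<in>A. q m (g m) * c m (g m))"
    using fin by (intro prod_sum_PiE) auto
  also have "\<dots> = (\<Sum>g\<in>A \<rightarrow>\<^sub>E X. (\<Prod>m\<in>A. q m (g m)) * h (g m0))"
    using m0 fin by (simp add: prod.distrib c_def)
  also have "\<dots> \<le> (\<Sum>g\<in>A \<rightarrow>\<^sub>E X. (\<Prod>m\<in>A. q m (g m)) * (MAX m\<in>A. h (g m)))"
    using q(1) m0 fin by (intro sum_mono mult_left_mono prod_nonneg) (auto simp: PiE_iff)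
  finally show "v \<le> \<dots>" .
qed (use fin in auto)

text \<open>One-shot form of the claim that randomness does not help: \<open>r i\<close> is a random
  encoder, \<open>t i\<close> a random decoder, \<open>\<beta>\<close> the law of their shared index
  \<open>i\<close>, and \<open>B\<close> bounds the score of every deterministic encoder for
  \<open>w\<close>.\<close>

lemma success_sum_le:
  fixes w :: "'x \<Rightarrow> 'y \<Rightarrow> real" and \<beta> :: "'i \<Rightarrow> real"
  assumes fin: "finite A" "A \<noteq> {}" "finite I" "finite X" "finite Y" "finite Z"
    and \<beta>: "\<And>i. i \<in> I \<Longrightarrow> 0 \<le> \<beta> i" "sum \<beta> I = 1"
    and r: "\<And>i m x. i \<in> I \<Longrightarrow> m \<in> A \<Longrightarrow> x \<in> X \<Longrightarrow> 0 \<le> r i m x"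
           "\<And>i m. i \<in> I \<Longrightarrow> m \<in> A \<Longrightarrow> (\<Sum>x\<in>X. r i m x) = 1"
    and t: "\<And>i y z. i \<in> I \<Longrightarrow> y \<in> Y \<Longrightarrow> z \<in> Z \<Longrightarrow> 0 \<le> t i y z"
           "\<And>i y. i \<in> I \<Longrightarrow> y \<in> Y \<Longrightarrow> (\<Sum>z\<in>Z. t i y z) = 1"
    and B: "\<And>g. g \<in> A \<rightarrow>\<^sub>E X \<Longrightarrow> (\<Sum>y\<in>Y. MAX m\<in>A. w (g m) y) \<le> B"
  shows "(\<Sum>z\<in>Z. MAX m\<in>A. \<Sum>i\<in>I. \<beta> i * (\<Sum>y\<in>Y. t i y z * (\<Sum>x\<in>X. r i m x * w x y))) \<le> B"
proof -
  let ?N = "\<lambda>i y. MAX m\<in>A. \<Sum>x\<in>X. r i m x * w x y"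
  have N: "(\<Sum>y\<in>Y. ?N i y) \<le> B" if i: "i \<in> I" for i
  proof -
    \<comment> \<open>Averages over deterministic encoders \<open>g\<close> with weights
      \<open>\<Prod>m\<in>A. r i m (g m)\<close>, which sum to 1; each \<open>g\<close> contributes
      at most \<open>B\<close>.\<close>
    have "(\<Sum>y\<in>Y. ?N i y) \<le>
        (\<Sum>y\<in>Y. \<Sum>g\<in>A \<rightarrow>\<^sub>E X. (\<Prod>m\<in>A. r i m (g m)) * (MAX m\<in>A. w (g m) y))"
      using i fin r by (intro sum_mono Max_expectation_le) auto
    also have "\<dots> = (\<Sum>g\<in>A \<rightarrow>\<^sub>E X. (\<Prod>m\<in>A. r i m (g m)) * (\<Sum>y\<in>Y. MAX m\<in>A. w (g m) y))"
      by (subst sum.swap) (simp add: sum_distrib_left)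
    also have "\<dots> \<le> (\<Sum>g\<in>A \<rightarrow>\<^sub>E X. (\<Prod>m\<in>A. r i m (g m)) * B)"
      using i r(1) B by (intro sum_mono mult_left_mono prod_nonneg) (auto simp: PiE_iff)
    also have "\<dots> = (\<Prod>m\<in>A. \<Sum>x\<in>X. r i m x) * B"
      using fin by (simp add: prod_sum_PiE sum_distrib_right)
    finally show ?thesis using r(2) i by simp
  qed
  \<comment> \<open>A maximum of non-negative combinations is at most the combination of the
    maxima.\<close>
  have "(MAX m\<in>A. \<Sum>i\<in>I. \<beta> i * (\<Sum>y\<in>Y. t i y z * (\<Sum>x\<in>X. r i m x * w x y)))
      \<le> (\<Sum>i\<in>I. \<beta> i * (\<Sum>y\<in>Y. t i y z * ?N i y))" if "z \<in> Z" for z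
    using that fin \<beta> t by (intro Max.boundedI) (auto intro!: sum_mono mult_left_mono)
  then have "(\<Sum>z\<in>Z. MAX m\<in>A. \<Sum>i\<in>I. \<beta> i * (\<Sum>y\<in>Y. t i y z * (\<Sum>x\<in>X. r i m x * w x y)))
      \<le> (\<Sum>z\<in>Z. \<Sum>i\<in>I. \<beta> i * (\<Sum>y\<in>Y. t i y z * ?N i y))"
    by (rule sum_mono)
  \<comment> \<open>The decoder disappears here, since each \<open>t i y\<close> has total mass 1
    over \<open>z\<close>.\<close>
  also have "\<dots> = (\<Sum>i\<in>I. \<beta> i * (\<Sum>y\<in>Y. (\<Sum>z\<in>Z. t i y z) * ?N i y))"
    by (simp add: sum_distrib_left sum_distrib_right sum.swap[of _ _ Z] mult.assoc)
  also have "\<dots> = (\<Sum>i\<in>I. \<beta> i * (\<Sum>y\<in>Y. ?N i y))"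
    using t(2) by simp
  also have "\<dots> \<le> (\<Sum>i\<in>I. \<beta> i * B)"
    using N \<beta> by (intro sum_mono mult_left_mono) auto
  also have "\<dots> = B"
    using \<beta>(2) by (simp flip: sum_distrib_right)
  finally show ?thesis .
qed

lemma finite_encoders: "finite (encoders a n M)"
  by (auto simp: encoders_def intro!: finite_PiE)

lemma encoders_nonempty: "a \<ge> 1 \<Longrightarrow> encoders a n M \<noteq> {}"
  by (auto simp: encoders_def PiE_eq_empty_iff)

text \<open>\<open>success_sum_le\<close> is applied to sequences of length \<open>n\<close>: its
  input, output and index alphabets are function spaces, and all its weights are product
  distributions.\<close>

lemma error_prob_contains_mono:
  assumes cont: "channel_contains ((a', b'), W') ((a, b), W)"
    and a: "a \<ge> 1" and M: "M \<ge> 1"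
  shows "error_prob n M ((a', b'), W') \<le> error_prob n M ((a, b), W)"
proof -
  obtain k \<alpha> R T where \<alpha>: "\<alpha> \<in> prob_dists k" and R: "\<And>i. i \<in> {1..k} \<Longrightarrow> R i \<in> DMC a a'"
    and T: "\<And>i. i \<in> {1..k} \<Longrightarrow> T i \<in> DMC b' b"
    and W: "\<And>x y. x \<in> {1..a} \<Longrightarrow> y \<in> {1..b} \<Longrightarrow> W (x, y) =
       (\<Sum>i=1..k. \<alpha> i * (\<Sum>y'=1..b'. T i (y', y) * (\<Sum>x'=1..a'. R i (x, x') * W' (x', y'))))"
    by (rule channel_containsE[OF cont]) (rule that; assumption)
  \<comment> \<open>\<open>M\<close> times the best success probability for \<open>W'\<close>, hence
    an upper bound on the sum of maxima of every deterministic encoder.\<close>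
  let ?B = "real M * (1 - error_prob n M ((a', b'), W'))"
  let ?I = "{1..n} \<rightarrow>\<^sub>E {1..k}" and ?X = "{1..n} \<rightarrow>\<^sub>E {1..a'}" and ?Y = "{1..n} \<rightarrow>\<^sub>E {1..b'}"
  have B: "(\<Sum>y\<in>?Y. MAX msg\<in>{1..M}. \<Prod>j=1..n. W' (g msg j, y j)) \<le> ?B"
    if "g \<in> {1..M} \<rightarrow>\<^sub>E ?X" for g
  proof -
    have "error_prob n M ((a', b'), W') \<le> encoder_error b' n M g W'"
      using that finite_encoders by (auto simp: encoders_def intro!: Min_le)
    then show ?thesis
      using M by (simp add: encoder_error_def field_simps)
  qed
  have "error_prob n M ((a', b'), W') \<le> encoder_error b n M E W" if E: "E \<in> encoders a n M" for E
  proof -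
    have Em: "E msg j \<in> {1..a}" if "msg \<in> {1..M}" "j \<in> {1..n}" for msg j
      using E that by (auto simp: encoders_def PiE_iff)
    \<comment> \<open>A product of sums is a sum over choice functions; applied to the three nested
      sums this yields sequences of indices, outputs and inputs.\<close>
    have "(\<Prod>j=1..n. W (E msg j, y j)) = (\<Sum>i\<in>?I. (\<Prod>j=1..n. \<alpha> (i j)) *
         (\<Sum>y'\<in>?Y. (\<Prod>j=1..n. T (i j) (y' j, y j)) *
           (\<Sum>x'\<in>?X. (\<Prod>j=1..n. R (i j) (E msg j, x' j)) * (\<Prod>j=1..n. W' (x' j, y' j)))))"
      if "msg \<in> {1..M}" "y \<in> {1..n} \<rightarrow>\<^sub>E {1..b}" for msg y
    proof -
      have "(\<Prod>j=1..n. W (E msg j, y j)) = (\<Prod>j=1..n. \<Sum>i=1..k. \<alpha> i *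
          (\<Sum>y'=1..b'. T i (y', y j) * (\<Sum>x'=1..a'. R i (E msg j, x') * W' (x', y'))))"
        using that Em by (intro prod.cong refl W) auto
      then show ?thesis
        by (simp only: prod_sum_PiE finite_atLeastAtMost prod.distrib)
    qed
    then have "(\<Sum>y\<in>{1..n} \<rightarrow>\<^sub>E {1..b}. MAX msg\<in>{1..M}. \<Prod>j=1..n. W (E msg j, y j)) =
       (\<Sum>y\<in>{1..n} \<rightarrow>\<^sub>E {1..b}. MAX msg\<in>{1..M}. \<Sum>i\<in>?I. (\<Prod>j=1..n. \<alpha> (i j)) *
         (\<Sum>y'\<in>?Y. (\<Prod>j=1..n. T (i j) (y' j, y j)) *
           (\<Sum>x'\<in>?X. (\<Prod>j=1..n. R (i j) (E msg j, x' j)) * (\<Prod>j=1..n. W' (x' j, y' j)))))"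
      by (intro sum.cong arg_cong[where f = Max] image_cong) auto
    also have "\<dots> \<le> ?B"
    proof (rule success_sum_le)
      show "(\<Sum>i\<in>?I. \<Prod>j=1..n. \<alpha> (i j)) = 1"
        using prod_sum_PiE[of "{1..n}" "\<lambda>_. {1..k}" "\<lambda>_. \<alpha>"] prob_dists_sum[OF \<alpha>] by simp
      show "(\<Sum>x\<in>?X. \<Prod>j=1..n. R (i j) (E msg j, x j)) = 1"
        if "i \<in> ?I" "msg \<in> {1..M}" for i msg
      proof -
        have "(\<Sum>x=1..a'. R (i j) (E msg j, x)) = 1" if "j \<in> {1..n}" for j
          using R[of "i j"] Em[of msg j] that \<open>i \<in> ?I\<close> \<open>msg \<in> {1..M}\<close>
          by (auto simp: DMC_def PiE_iff)
        then show ?thesis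
          using prod_sum_PiE[of "{1..n}" "\<lambda>_. {1..a'}" "\<lambda>j x. R (i j) (E msg j, x)"] by simp
      qed
      show "(\<Sum>z\<in>{1..n} \<rightarrow>\<^sub>E {1..b}. \<Prod>j=1..n. T (i j) (y j, z j)) = 1"
        if "i \<in> ?I" "y \<in> ?Y" for i y
      proof -
        have "(\<Sum>z=1..b. T (i j) (y j, z)) = 1" if "j \<in> {1..n}" for j
          using T[of "i j"] that \<open>i \<in> ?I\<close> \<open>y \<in> ?Y\<close> by (auto simp: DMC_def PiE_iff)
        then show ?thesis
          using prod_sum_PiE[of "{1..n}" "\<lambda>_. {1..b}" "\<lambda>j z. T (i j) (y j, z)"] by simp
      qed
      show "0 \<le> (\<Prod>j=1..n. \<alpha> (i j))" if "i \<in> ?I" for i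
        using \<alpha> that by (intro prod_nonneg) (auto simp: prob_dists_def PiE_iff)
      show "0 \<le> (\<Prod>j=1..n. R (i j) (E msg j, x j))"
        if "i \<in> ?I" "msg \<in> {1..M}" "x \<in> ?X" for i msg x
      proof (rule prod_nonneg)
        fix j assume "j \<in> {1..n}"
        then show "0 \<le> R (i j) (E msg j, x j)"
          using R[of "i j"] Em[of msg j] that by (auto simp: DMC_def PiE_iff)
      qed
      show "0 \<le> (\<Prod>j=1..n. T (i j) (y j, z j))"
        if "i \<in> ?I" "y \<in> ?Y" "z \<in> {1..n} \<rightarrow>\<^sub>E {1..b}" for i y z
      proof (rule prod_nonneg)
        fix j assume "j \<in> {1..n}"
        then show "0 \<le> T (i j) (y j, z j)"
          using T[of "i j"] that by (auto simp: DMC_def PiE_iff)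
      qed
      show "(\<Sum>y\<in>?Y. MAX msg\<in>{1..M}. \<Prod>j=1..n. W' (g msg j, y j)) \<le> ?B"
        if "g \<in> {1..M} \<rightarrow>\<^sub>E ?X" for g
        using B[OF that] .
    qed (use M in \<open>auto intro!: finite_PiE\<close>)
    finally show ?thesis
      using M by (simp add: encoder_error_def field_simps)
  qed
  then show ?thesis
    using finite_encoders encoders_nonempty[OF a] by (subst (2) error_prob.simps, intro Min.boundedI) auto
qed

section \<open>Range and continuity of the error probability\<close>

lemma error_prob_bounds:
  assumes a: "a \<ge> 1" and M: "M \<ge> 1" and W: "W \<in> DMC a b"
  shows "error_prob n M ((a, b), W) \<in> {0..1}"
proof -
  have "encoder_error b n M E W \<in> {0..1}" if E: "E \<in> encoders a n M" for E
  proof -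
    have nn: "0 \<le> W (E msg j, y j)"
      if "msg \<in> {1..M}" "y \<in> {1..n} \<rightarrow>\<^sub>E {1..b}" "j \<in> {1..n}" for msg y j
      using W E that by (auto simp: DMC_def encoders_def PiE_iff)
    let ?S = "\<Sum>y\<in>{1..n} \<rightarrow>\<^sub>E {1..b}. MAX msg\<in>{1..M}. \<Prod>j=1..n. W (E msg j, y j)"
    \<comment> \<open>A maximum of non-negative numbers is at most their sum, and each message
      contributes total probability 1.\<close>
    have "?S \<le> (\<Sum>y\<in>{1..n} \<rightarrow>\<^sub>E {1..b}. \<Sum>msg=1..M. \<Prod>j=1..n. W (E msg j, y j))"
      using M nn by (intro sum_mono Max.boundedI) (auto intro!: member_le_sum prod_nonneg)
    also have "\<dots> = (\<Sum>msg=1..M. \<Prod>j=1..n. \<Sum>y=1..b. W (E msg j, y))"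
      by (subst sum.swap) (simp add: prod_sum_PiE)
    also have "\<dots> = (\<Sum>msg=1..M. 1)"
      using W E by (intro sum.cong refl prod.neutral) (auto simp: DMC_def encoders_def PiE_iff)
    finally have "?S \<le> real M" by simp
    moreover have "0 \<le> ?S"
    proof (rule sum_nonneg)
      fix y assume "y \<in> {1..n} \<rightarrow>\<^sub>E {1..b}"
      then have "0 \<le> (\<Prod>j=1..n. W (E 1 j, y j))"
        using nn M by (intro prod_nonneg) auto
      also have "\<dots> \<le> (MAX msg\<in>{1..M}. \<Prod>j=1..n. W (E msg j, y j))"
        using M by (intro Max_ge) auto
      finally show "0 \<le> \<dots>" .
    qed
    ultimately show ?thesis
      using M by (simp add: encoder_error_def field_simps)
  qed
  moreover have "error_prob n M ((a, b), W) \<in> (\<lambda>E. encoder_error b n M E W) ` encoders a n M"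
    using finite_encoders encoders_nonempty[OF a] by (simp add: Min_in)
  ultimately show ?thesis by auto
qed

lemma continuous_on_Max:
  fixes f :: "'i \<Rightarrow> 'a::topological_space \<Rightarrow> 'b::linorder_topology"
  assumes "finite A" "A \<noteq> {}" "\<And>i. i \<in> A \<Longrightarrow> continuous_on S (f i)"
  shows "continuous_on S (\<lambda>x. MAX i\<in>A. f i x)"
  using assms by (induction A rule: finite_ne_induct) (auto intro!: continuous_on_max)

lemma continuous_on_Min:
  fixes f :: "'i \<Rightarrow> 'a::topological_space \<Rightarrow> 'b::linorder_topology"
  assumes "finite A" "A \<noteq> {}" "\<And>i. i \<in> A \<Longrightarrow> continuous_on S (f i)"
  shows "continuous_on S (\<lambda>x. MIN i\<in>A. f i x)"
  using assms by (induction A rule: finite_ne_induct) (auto intro!: continuous_on_min)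

lemma continuous_on_apply: "continuous_on S (\<lambda>f. f i :: 'b::topological_space)"
  by (rule continuous_on_subset[OF continuous_on_product_coordinates]) simp

lemma continuous_on_error_prob:
  assumes "a \<ge> 1" "M \<ge> 1"
  shows "continuous_on S (\<lambda>W. error_prob n M ((a, b), W))"
  using assms finite_encoders encoders_nonempty unfolding error_prob.simps encoder_error_def
  by (intro continuous_on_Min continuous_intros continuous_on_Max continuous_on_apply) auto


section \<open>Capacity\<close>

text \<open>\<open>ac\<close> is absolute continuity. It excludes terms with
  \<open>v j = 0 < u j\<close>, which should be infinite but are finite under division by
  zero.\<close>

lemma log_sum_inequality:
  fixes u v :: "'j \<Rightarrow> real"
  assumes J: "finite J" and u: "\<And>j. j \<in> J \<Longrightarrow> 0 \<le> u j" and v: "\<And>j. j \<in> J \<Longrightarrow> 0 \<le> v j"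
    and ac: "\<And>j. j \<in> J \<Longrightarrow> v j = 0 \<Longrightarrow> u j = 0"
  shows "sum u J * ln (sum u J / sum v J) \<le> (\<Sum>j\<in>J. u j * ln (u j / v j))"
proof (cases "sum u J = 0")
  case True
  then have "\<And>j. j \<in> J \<Longrightarrow> u j = 0"
    using J u by (simp add: sum_nonneg_eq_0_iff)
  then show ?thesis using True by simp
next
  case False
  let ?U = "sum u J" and ?V = "sum v J"
  have U: "?U > 0" using False u sum_nonneg[of J u] by simp
  obtain j0 where "j0 \<in> J" "u j0 \<noteq> 0" using False by (meson sum.neutral)
  then have "v j0 \<noteq> 0" using ac by blast
  then have V: "?V > 0"
    using \<open>j0 \<in> J\<close> v[of j0] member_le_sum[of j0 J v] v J by force
  \<comment> \<open>The tangent bound \<open>ln z \<le> z - 1\<close> at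
    \<open>z = v j * ?U / (u j * ?V)\<close>. The corrections \<open>u j - v j * ?U / ?V\<close> sum
    to zero over \<open>J\<close>.\<close>
  have "u j * ln (?U / ?V) + (u j - v j * ?U / ?V) \<le> u j * ln (u j / v j)" if j: "j \<in> J" for j
  proof (cases "u j = 0")
    case True
    then show ?thesis using v[OF j] U V by simp
  next
    case False
    then have p: "u j > 0" "v j > 0" using u v ac j by (force simp: order_le_less)+
    have "ln (v j * ?U / (u j * ?V)) \<le> v j * ?U / (u j * ?V) - 1"
      using p U V by (intro ln_le_minus_one) simp
    then have "u j * ln (v j * ?U / (u j * ?V)) \<le> u j * (v j * ?U / (u j * ?V) - 1)"
      using p by (intro mult_left_mono) auto
    then show ?thesis
      using p U V by (simp add: ln_div ln_mult algebra_simps)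
  qed
  then have "(\<Sum>j\<in>J. u j * ln (?U / ?V) + (u j - v j * ?U / ?V)) \<le> (\<Sum>j\<in>J. u j * ln (u j / v j))"
    by (rule sum_mono)
  moreover have "(\<Sum>j\<in>J. u j * ln (?U / ?V) + (u j - v j * ?U / ?V)) = ?U * ln (?U / ?V)"
    using V by (simp add: sum.distrib sum_subtractf flip: sum_distrib_right sum_divide_distrib)
  ultimately show ?thesis by simp
qed

section \<open>Formulas for the mutual information\<close>

text \<open>Also used to push an input law through a channel \<open>R\<close>. The function is not
  extensional, so it is restricted wherever a member of \<open>prob_dists\<close> is
  required.\<close>

definition output_dist :: "nat \<Rightarrow> (nat \<Rightarrow> real) \<Rightarrow> (nat \<times> nat \<Rightarrow> real) \<Rightarrow> nat \<Rightarrow> real" where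
  "output_dist n p W y = (\<Sum>x=1..n. p x * W (x, y))"

lemma output_dist_nonneg:
  "p \<in> prob_dists n \<Longrightarrow> W \<in> DMC n m \<Longrightarrow> y \<in> {1..m} \<Longrightarrow> 0 \<le> output_dist n p W y"
  unfolding output_dist_def by (intro sum_nonneg mult_nonneg_nonneg prob_dists_nonneg DMC_nonneg)

text \<open>Absolute continuity of the joint law with respect to the product of its marginals; this
  controls the zero denominators below.\<close>

lemma output_dist_eq_0D:
  assumes "p \<in> prob_dists n" "W \<in> DMC n m" "y \<in> {1..m}" "output_dist n p W y = 0" "x \<in> {1..n}"
  shows "p x * W (x, y) = 0"
  using assms prob_dists_nonneg DMC_nonneg
  by (subst (asm) output_dist_def, subst (asm) sum_nonneg_eq_0_iff) (auto simp: mult_nonneg_nonneg)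

text \<open>The factor \<open>p x\<close> cancels inside the logarithm, and terms with
  \<open>p x = 0\<close> vanish. What remains is the \<open>p\<close>-average of the divergences of
  the rows of \<open>W\<close> from the output law.\<close>

lemma channel_information_divergence:
  assumes "p \<in> prob_dists n" "W \<in> DMC n m"
  shows "channel_information n m p W =
    (\<Sum>x=1..n. p x * (\<Sum>y=1..m. W (x, y) * ln (W (x, y) / output_dist n p W y)))"
  unfolding channel_information_eq[OF assms] output_dist_def
  by (auto simp: mult.assoc simp flip: sum_distrib_left intro!: sum.cong)

text \<open>Output entropy minus conditional entropy. Unlike the divergence form it contains no
  quotient, only the function \<open>x * ln x\<close>, so continuity extends to the
  boundary.\<close>

lemma channel_information_entropy:
  assumes p: "p \<in> prob_dists n" and W: "W \<in> DMC n m"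
  shows "channel_information n m p W =
    (\<Sum>x=1..n. p x * (\<Sum>y=1..m. W (x, y) * ln (W (x, y))))
      - (\<Sum>y=1..m. output_dist n p W y * ln (output_dist n p W y))"
proof -
  have "p x * (W (x, y) * ln (W (x, y) / output_dist n p W y)) =
      p x * (W (x, y) * ln (W (x, y))) - p x * W (x, y) * ln (output_dist n p W y)"
    if xy: "x \<in> {1..n}" "y \<in> {1..m}" for x y
  proof (cases "p x * W (x, y) = 0")
    case False
    then have "output_dist n p W y \<noteq> 0"
      using output_dist_eq_0D[OF p W xy(2) _ xy(1)] by blast
    then have "output_dist n p W y > 0" "W (x, y) > 0"
      using False output_dist_nonneg[OF p W xy(2)] DMC_nonneg[OF W xy] by auto
    then show ?thesis by (simp add: ln_div algebra_simps)
  qed auto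
  then have "channel_information n m p W =
      (\<Sum>x=1..n. \<Sum>y=1..m. p x * (W (x, y) * ln (W (x, y))) - p x * W (x, y) * ln (output_dist n p W y))"
    by (simp add: channel_information_divergence[OF p W] sum_distrib_left)
  also have "\<dots> = (\<Sum>x=1..n. p x * (\<Sum>y=1..m. W (x, y) * ln (W (x, y))))
      - (\<Sum>x=1..n. \<Sum>y=1..m. p x * W (x, y) * ln (output_dist n p W y))"
    by (simp add: sum_subtractf sum_distrib_left)
  also have "(\<Sum>x=1..n. \<Sum>y=1..m. p x * W (x, y) * ln (output_dist n p W y)) =
      (\<Sum>y=1..m. output_dist n p W y * ln (output_dist n p W y))"
    by (subst sum.swap) (simp add: output_dist_def sum_distrib_right)
  finally show ?thesis .
qed

section \<open>Joint continuity of the information\<close>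

lemma continuous_on_x_ln_x: "continuous_on {0..} (\<lambda>x::real. x * ln x)"
  unfolding continuous_on_def
proof
  fix x :: real assume "x \<in> {0..}"
  show "((\<lambda>x. x * ln x) \<longlongrightarrow> x * ln x) (at x within {0..})"
  proof (cases "x = 0")
    case True
    have "((\<lambda>x::real. x * ln x) \<longlongrightarrow> 0) (at_right 0)" by real_asymp
    then show ?thesis using True by (simp add: at_within_Ici_at_right)
  next
    case False
    then show ?thesis using \<open>x \<in> {0..}\<close> by (intro tendsto_intros) auto
  qed
qed

lemma continuous_on_channel_information:
  "continuous_on (prob_dists n \<times> DMC n m) (\<lambda>(p, W). channel_information n m p W)"
proof -
  let ?D = "prob_dists n \<times> DMC n m"
  have fst: "continuous_on ?D (\<lambda>z. fst z x)" for x
    by (rule continuous_on_compose2[OF continuous_on_product_coordinates[of x]]) (auto intro: continuous_intros)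
  have snd: "continuous_on ?D (\<lambda>z. snd z x)" for x
    by (rule continuous_on_compose2[OF continuous_on_product_coordinates[of x]]) (auto intro: continuous_intros)
  have out: "continuous_on ?D (\<lambda>z. output_dist n (fst z) (snd z) y)" for y
    unfolding output_dist_def by (intro continuous_intros fst snd)
  have "continuous_on ?D (\<lambda>z.
    (\<Sum>x=1..n. fst z x * (\<Sum>y=1..m. snd z (x, y) * ln (snd z (x, y))))
      - (\<Sum>y=1..m. output_dist n (fst z) (snd z) y * ln (output_dist n (fst z) (snd z) y)))"
    by (intro continuous_on_diff continuous_on_sum continuous_on_mult fst
        continuous_on_compose2[OF continuous_on_x_ln_x] snd out)
      (auto simp: DMC_nonneg output_dist_nonneg)
  then show ?thesis
    by (rule continuous_on_eq) (auto simp: channel_information_entropy)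
qed

section \<open>Compactness of the spaces of distributions and channels\<close>

text \<open>Tychonoff on the full function space: extensionality means that each factor off
  \<open>I\<close> is the compact singleton \<open>{undefined}\<close>.\<close>

lemma compact_extensional_box:
  fixes a b :: real
  shows "compact ((I :: 'i set) \<rightarrow>\<^sub>E {a..b})"
proof -
  have "compactin (product_topology (\<lambda>_. euclideanreal) (UNIV :: 'i set))
      (PiE UNIV (\<lambda>i. if i \<in> I then {a..b} else {undefined}))"
    by (simp add: compactin_PiE)
  moreover have "PiE UNIV (\<lambda>i. if i \<in> I then {a..b} else {undefined}) = I \<rightarrow>\<^sub>E {a..b}"
    by (auto simp: PiE_iff extensional_def split: if_splits)
  ultimately show ?thesis
    by (simp add: euclidean_product_topology)
qed

lemma compact_prob_dists: "compact (prob_dists n)"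
proof -
  have "p \<in> {1..n} \<rightarrow>\<^sub>E {0..1}" if p: "p \<in> prob_dists n" for p
  proof
    fix x assume "x \<in> {1..n}"
    then show "p x \<in> {0..1}"
      using p member_le_sum[of x "{1..n}" p] by (simp add: prob_dists_def)
  qed (use p in \<open>simp add: prob_dists_def PiE_iff extensional_def\<close>)
  then have "prob_dists n \<subseteq> {1..n} \<rightarrow>\<^sub>E {0..1}"
    by (rule subsetI)
  moreover have "({1..n} \<rightarrow>\<^sub>E {0..1}) \<inter> {p. (\<Sum>x=1..n. p x) = 1} \<subseteq> prob_dists n"
    by (simp add: subset_iff prob_dists_def PiE_iff)
  moreover have "prob_dists n \<subseteq> {p. (\<Sum>x=1..n. p x) = 1}"
    by (simp add: subset_iff prob_dists_def)
  ultimately have "prob_dists n = ({1..n} \<rightarrow>\<^sub>E {0..1}) \<inter> {p. (\<Sum>x=1..n. p x) = 1}"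
    by blast
  moreover have "closed {p::nat \<Rightarrow> real. (\<Sum>x=1..n. p x) = 1}"
    by (intro closed_Collect_eq continuous_intros continuous_on_apply)
  ultimately show ?thesis
    by (simp add: compact_Int_closed compact_extensional_box)
qed

lemma compact_DMC: "compact (DMC n m)"
proof -
  have "W \<in> {1..n} \<times> {1..m} \<rightarrow>\<^sub>E {0..1}" if W: "W \<in> DMC n m" for W
  proof
    fix z assume "z \<in> {1..n} \<times> {1..m}"
    then show "W z \<in> {0..1}"
      using W member_le_sum[of "snd z" "{1..m}" "\<lambda>y. W (fst z, y)"] by (auto simp: DMC_def)
  next
    fix z assume "z \<notin> {1..n} \<times> {1..m}"
    moreover have "W \<in> {1..n} \<times> {1..m} \<rightarrow>\<^sub>E UNIV"
      using W by (simp add: DMC_def)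
    ultimately show "W z = undefined"
      by (rule PiE_arb[rotated])
  qed
  then have "DMC n m \<subseteq> {1..n} \<times> {1..m} \<rightarrow>\<^sub>E {0..1}"
    by (rule subsetI)
  moreover have "({1..n} \<times> {1..m} \<rightarrow>\<^sub>E {0..1}) \<inter> (\<Inter>x\<in>{1..n}. {W. (\<Sum>y=1..m. W (x, y)) = 1}) \<subseteq> DMC n m"
    by (simp add: subset_iff DMC_def PiE_iff)
  moreover have "DMC n m \<subseteq> (\<Inter>x\<in>{1..n}. {W. (\<Sum>y=1..m. W (x, y)) = 1})"
    by (simp add: subset_iff DMC_def)
  ultimately have "DMC n m = ({1..n} \<times> {1..m} \<rightarrow>\<^sub>E {0..1}) \<inter> (\<Inter>x\<in>{1..n}. {W. (\<Sum>y=1..m. W (x, y)) = 1})"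
    by blast
  moreover have "closed (\<Inter>x\<in>{1..n}. {W::nat \<times> nat \<Rightarrow> real. (\<Sum>y=1..m. W (x, y)) = 1})"
    by (intro closed_INT ballI closed_Collect_eq continuous_intros continuous_on_apply)
  ultimately show ?thesis
    by (simp add: compact_Int_closed compact_extensional_box)
qed

section \<open>Existence, sign and continuity of the capacity\<close>

lemma point_mass_prob_dists: "x0 \<in> {1..n} \<Longrightarrow> (\<lambda>x\<in>{1..n}. if x = x0 then 1 else 0) \<in> prob_dists n"
  by (auto simp: prob_dists_def)

text \<open>The extreme value theorem supplies a maximiser; only then does \<open>GREATEST\<close>
  denote the maximum.\<close>

lemma capacity_attained:
  assumes n: "n \<ge> 1" and W: "W \<in> DMC n m"
  obtains p where "p \<in> prob_dists n" "capacity ((n, m), W) = channel_information n m p W"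
    "\<And>p'. p' \<in> prob_dists n \<Longrightarrow> channel_information n m p' W \<le> capacity ((n, m), W)"
proof -
  have "continuous_on (prob_dists n) (\<lambda>p. case (p, W) of (p, W) \<Rightarrow> channel_information n m p W)"
    by (rule continuous_on_compose2[OF continuous_on_channel_information[of n m]])
      (use W in \<open>auto intro!: continuous_intros\<close>)
  then have "continuous_on (prob_dists n) (\<lambda>p. channel_information n m p W)"
    by simp
  moreover have "prob_dists n \<noteq> {}"
    using point_mass_prob_dists[of 1 n] n by auto
  ultimately obtain p where p: "p \<in> prob_dists n"
    "\<And>p'. p' \<in> prob_dists n \<Longrightarrow> channel_information n m p' W \<le> channel_information n m p W"
    using continuous_attains_sup[OF compact_prob_dists] by meson
  then have "capacity ((n, m), W) = channel_information n m p W"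
    unfolding capacity.simps by (intro Greatest_equality) auto
  with p show thesis by (intro that) auto
qed

lemma capacity_nonneg:
  assumes n: "n \<ge> 1" and W: "W \<in> DMC n m"
  shows "0 \<le> capacity ((n, m), W)"
proof -
  \<comment> \<open>A constant input carries no information: the output law is row 1 of
    \<open>W\<close>, so each logarithm is \<open>ln 1\<close> or has weight zero.\<close>
  let ?p = "\<lambda>x\<in>{1..n}. if x = 1 then 1 else 0::real"
  have p: "?p \<in> prob_dists n" using n by (intro point_mass_prob_dists) simp
  have out: "output_dist n ?p W y = W (1, y)" for y
    using n by (simp add: output_dist_def if_distrib if_distribR cong: if_cong)
  have "channel_information n m ?p W = 0"
    unfolding channel_information_divergence[OF p W] out
    by (intro sum.neutral ballI) (auto intro!: sum.neutral)
  then show ?thesis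
    using capacity_attained[OF n W] p by metis
qed

lemma continuous_on_capacity:
  assumes n: "n \<ge> 1"
  shows "continuous_on (DMC n m) (\<lambda>W. capacity ((n, m), W))"
  unfolding continuous_on_iff
proof (intro ballI allI impI)
  fix W and e :: real assume W: "W \<in> DMC n m" and e: "0 < e"
  have "uniformly_continuous_on (prob_dists n \<times> DMC n m) (\<lambda>(p, W). channel_information n m p W)"
    by (intro compact_uniformly_continuous continuous_on_channel_information compact_Times
        compact_prob_dists compact_DMC)
  then obtain d where d: "d > 0" "\<And>z z'. z \<in> prob_dists n \<times> DMC n m \<Longrightarrow> z' \<in> prob_dists n \<times> DMC n m \<Longrightarrow>
      dist z' z < d \<Longrightarrow> dist (case z' of (p, W) \<Rightarrow> channel_information n m p W)
        (case z of (p, W) \<Rightarrow> channel_information n m p W) < e"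
    unfolding uniformly_continuous_on_def using e by meson
  \<comment> \<open>The same \<open>d\<close> serves every input law, so an optimal input for
    \<open>U\<close> loses less than \<open>e\<close> when used on \<open>V\<close>. Exchanging the
    channels gives the other bound.\<close>
  have le: "capacity ((n, m), U) < capacity ((n, m), V) + e"
    if U: "U \<in> DMC n m" and V: "V \<in> DMC n m" and UV: "dist U V < d" for U V
  proof -
    obtain p where p: "p \<in> prob_dists n" "capacity ((n, m), U) = channel_information n m p U"
      using capacity_attained[OF n U] by metis
    have "dist (channel_information n m p U) (channel_information n m p V) < e"
      using d(2)[of "(p, V)" "(p, U)"] p U V UV by (simp add: dist_Pair_Pair)
    moreover have "channel_information n m p V \<le> capacity ((n, m), V)"
      using capacity_attained[OF n V] p by metis
    ultimately show ?thesis using p by (simp add: dist_real_def)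
  qed
  show "\<exists>d>0. \<forall>W'\<in>DMC n m. dist W' W < d \<longrightarrow> dist (capacity ((n, m), W')) (capacity ((n, m), W)) < e"
  proof (intro exI conjI ballI impI)
    fix W' assume "W' \<in> DMC n m" "dist W' W < d"
    then show "dist (capacity ((n, m), W')) (capacity ((n, m), W)) < e"
      using le[of W W'] le[of W' W] W by (simp add: dist_real_def dist_commute del: capacity.simps)
  qed (fact d(1))
qed

section \<open>Data processing and monotonicity of the capacity\<close>

lemma push_forward_prob_dists:
  assumes p: "p \<in> prob_dists n" and R: "R \<in> DMC n n'"
  shows "restrict (output_dist n p R) {1..n'} \<in> prob_dists n'"
proof -
  have "(\<Sum>x'=1..n'. output_dist n p R x') = (\<Sum>x=1..n. p x * (\<Sum>x'=1..n'. R (x, x')))"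
    unfolding output_dist_def by (subst sum.swap) (simp add: sum_distrib_left)
  then show ?thesis
    using DMC_sum[OF R] prob_dists_sum[OF p] output_dist_nonneg[OF p R]
    by (simp add: prob_dists_def del: One_nat_def)
qed

text \<open>Data processing and convexity of the information in the channel, both obtained from a
  single use of the log-sum inequality over the triples of hidden variables \<open>(i, y', x')\<close>.\<close>

lemma channel_information_mixture_le:
  assumes p: "p \<in> prob_dists n" and \<alpha>: "\<alpha> \<in> prob_dists k"
    and R: "\<And>i. i \<in> {1..k} \<Longrightarrow> R i \<in> DMC n n'" and T: "\<And>i. i \<in> {1..k} \<Longrightarrow> T i \<in> DMC m' m"
    and W': "W' \<in> DMC n' m'" and WD: "W \<in> DMC n m"
    and W: "\<And>x y. x \<in> {1..n} \<Longrightarrow> y \<in> {1..m} \<Longrightarrow> W (x, y) =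
       (\<Sum>i=1..k. \<alpha> i * (\<Sum>y'=1..m'. T i (y', y) * (\<Sum>x'=1..n'. R i (x, x') * W' (x', y'))))"
  shows "channel_information n m p W \<le>
    (\<Sum>i=1..k. \<alpha> i * channel_information n' m' (restrict (output_dist n p (R i)) {1..n'}) W')"
proof -
  \<comment> \<open>Given the index \<open>i\<close>, \<open>P i\<close> is the law of the input of
    \<open>W'\<close>, \<open>Q i\<close> the law of its output, and \<open>L i\<close> the
    information density.\<close>
  define P where "P i = restrict (output_dist n p (R i)) {1..n'}" for i
  define Q where "Q i = output_dist n' (P i) W'" for i
  define L where "L i x' y' = ln (W' (x', y') / Q i y')" for i x' y'
  have P: "P i \<in> prob_dists n'" if "i \<in> {1..k}" for i
    unfolding P_def using p R[OF that] by (rule push_forward_prob_dists)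
  have Q: "Q i y' = (\<Sum>x=1..n. p x * (\<Sum>x'=1..n'. R i (x, x') * W' (x', y')))" for i y'
    unfolding Q_def P_def output_dist_def
    by (simp add: sum_distrib_left sum_distrib_right mult.assoc) (rule sum.swap)
  have Qnn: "0 \<le> Q i y'" if "i \<in> {1..k}" "y' \<in> {1..m'}" for i y'
    unfolding Q_def using P W' that by (intro output_dist_nonneg)
  have q: "output_dist n p W y = (\<Sum>i=1..k. \<alpha> i * (\<Sum>y'=1..m'. T i (y', y) * Q i y'))"
    if y: "y \<in> {1..m}" for y
  proof -
    have "output_dist n p W y = (\<Sum>x=1..n. \<Sum>i=1..k. \<Sum>y'=1..m'.
        \<alpha> i * (T i (y', y) * (p x * (\<Sum>x'=1..n'. R i (x, x') * W' (x', y')))))"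
      unfolding output_dist_def using y
      by (intro sum.cong refl) (simp add: W sum_distrib_left mult_ac)
    also have "\<dots> = (\<Sum>i=1..k. \<Sum>y'=1..m'. \<Sum>x=1..n.
        \<alpha> i * (T i (y', y) * (p x * (\<Sum>x'=1..n'. R i (x, x') * W' (x', y')))))"
      by (subst sum.swap) (intro sum.cong refl sum.swap)
    finally show ?thesis
      by (simp add: Q sum_distrib_left)
  qed
  let ?J = "{1..k} \<times> {1..m'} \<times> {1..n'}"
  \<comment> \<open>Restricted to \<open>p x > 0\<close>, where absolute continuity can be derived;
    other \<open>x\<close> have weight zero in the information.\<close>
  have pt: "W (x, y) * ln (W (x, y) / output_dist n p W y) \<le>
      (\<Sum>i=1..k. \<Sum>y'=1..m'. \<Sum>x'=1..n'. \<alpha> i * T i (y', y) * R i (x, x') * W' (x', y') * L i x' y')"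
    if x: "x \<in> {1..n}" "p x > 0" and y: "y \<in> {1..m}" for x y
  proof -
    \<comment> \<open>\<open>u\<close> is the joint probability of the hidden variables and
      \<open>y\<close>, given \<open>x\<close>. In \<open>v\<close> the output of \<open>W'\<close>
      is made independent of its input, given \<open>i\<close>. Summing out the hidden variables
      gives \<open>W (x, y)\<close> and the output law at \<open>y\<close>.\<close>
    define u where "u = (\<lambda>(i, y', x'). \<alpha> i * T i (y', y) * R i (x, x') * W' (x', y'))"
    define v where "v = (\<lambda>(i, y', x'). \<alpha> i * T i (y', y) * R i (x, x') * Q i y')"
    have nn: "0 \<le> \<alpha> i" "0 \<le> T i (y', y)" "0 \<le> R i (x, x')" "0 \<le> W' (x', y')" "0 \<le> Q i y'"
      if "i \<in> {1..k}" "y' \<in> {1..m'}" "x' \<in> {1..n'}" for i y' x'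
      using that prob_dists_nonneg[OF \<alpha>] DMC_nonneg[OF T] DMC_nonneg[OF R] DMC_nonneg[OF W'] Qnn x y
      by blast+
    \<comment> \<open>If \<open>Q i y' = 0\<close> but \<open>W' (x', y')\<close> is non-zero, then
      \<open>P i x' = 0\<close>, and \<open>p x > 0\<close> forces
      \<open>R i (x, x') = 0\<close>.\<close>
    have ac: "R i (x, x') = 0"
      if h: "i \<in> {1..k}" "y' \<in> {1..m'}" "x' \<in> {1..n'}" and 0: "Q i y' = 0" "W' (x', y') \<noteq> 0" for i y' x'
    proof -
      have "P i x' * W' (x', y') = 0"
        using output_dist_eq_0D[OF P[OF h(1)] W' h(2) _ h(3)] 0 by (simp add: Q_def)
      then have "P i x' = 0"
        using 0 by simp
      then have "p x * R i (x, x') = 0"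
        using h by (intro output_dist_eq_0D[OF p R[OF h(1)] h(3) _ x(1)]) (simp add: P_def)
      then show ?thesis using x by simp
    qed
    have su: "sum u ?J = W (x, y)"
      using x y by (simp add: u_def W sum_distrib_left mult_ac flip: sum.cartesian_product)
    have "(\<Sum>x'=1..n'. \<alpha> i * T i (y', y) * R i (x, x') * Q i y') = \<alpha> i * (T i (y', y) * Q i y')"
      if "i \<in> {1..k}" for i y'
    proof -
      have "(\<Sum>x'=1..n'. \<alpha> i * T i (y', y) * R i (x, x') * Q i y') =
          \<alpha> i * (T i (y', y) * Q i y') * (\<Sum>x'=1..n'. R i (x, x'))"
        by (simp add: sum_distrib_left mult_ac)
      then show ?thesis using DMC_sum[OF R[OF that] x(1)] by simp
    qed
    then have sv: "sum v ?J = output_dist n p W y"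
      using y by (simp add: v_def q sum_distrib_left flip: sum.cartesian_product)
    have "W (x, y) * ln (W (x, y) / output_dist n p W y) \<le> (\<Sum>j\<in>?J. u j * ln (u j / v j))"
      unfolding su[symmetric] sv[symmetric]
      by (rule log_sum_inequality) (auto simp: u_def v_def nn ac)
    \<comment> \<open>The common factors of \<open>u\<close> and \<open>v\<close> cancel in the
      ratio, leaving \<open>L\<close>; where they vanish, so does \<open>u\<close>.\<close>
    also have "\<dots> = (\<Sum>(i, y', x')\<in>?J. \<alpha> i * T i (y', y) * R i (x, x') * W' (x', y') * L i x' y')"
      by (intro sum.cong refl) (auto simp: u_def v_def L_def)
    finally show ?thesis
      by (simp flip: sum.cartesian_product)
  qed
  have "channel_information n m p W =
      (\<Sum>x=1..n. p x * (\<Sum>y=1..m. W (x, y) * ln (W (x, y) / output_dist n p W y)))"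
    by (rule channel_information_divergence[OF p WD])
  also have "\<dots> \<le> (\<Sum>x=1..n. p x * (\<Sum>y=1..m. \<Sum>i=1..k. \<Sum>y'=1..m'. \<Sum>x'=1..n'.
      \<alpha> i * T i (y', y) * R i (x, x') * W' (x', y') * L i x' y'))"
  proof (rule sum_mono)
    fix x assume x: "x \<in> {1..n}"
    show "p x * (\<Sum>y=1..m. W (x, y) * ln (W (x, y) / output_dist n p W y)) \<le>
      p x * (\<Sum>y=1..m. \<Sum>i=1..k. \<Sum>y'=1..m'. \<Sum>x'=1..n'.
        \<alpha> i * T i (y', y) * R i (x, x') * W' (x', y') * L i x' y')"
    proof (cases "p x = 0")
      case False
      then have "p x > 0" using prob_dists_nonneg[OF p x] by simp
      then show ?thesis using pt x by (intro mult_left_mono sum_mono) auto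
    qed simp
  qed
  also have "\<dots> = (\<Sum>x=1..n. p x * (\<Sum>i=1..k. \<Sum>y'=1..m'. \<Sum>x'=1..n'.
      \<alpha> i * R i (x, x') * W' (x', y') * L i x' y'))"
  proof -
    have "(\<Sum>y=1..m. \<Sum>i=1..k. \<Sum>y'=1..m'. \<Sum>x'=1..n'.
        \<alpha> i * T i (y', y) * R i (x, x') * W' (x', y') * L i x' y') =
      (\<Sum>i=1..k. \<Sum>y'=1..m'. \<Sum>x'=1..n'. \<alpha> i * R i (x, x') * W' (x', y') * L i x' y')" for x
    proof -
      have "(\<Sum>y=1..m. \<Sum>i=1..k. \<Sum>y'=1..m'. \<Sum>x'=1..n'.
          \<alpha> i * T i (y', y) * R i (x, x') * W' (x', y') * L i x' y') =
        (\<Sum>i=1..k. \<Sum>y'=1..m'. \<Sum>x'=1..n'. \<Sum>y=1..m.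
          \<alpha> i * T i (y', y) * R i (x, x') * W' (x', y') * L i x' y')"
        \<comment> \<open>With the outer index set fixed, the swap carries the sum over
          \<open>y\<close> inward past the other three.\<close>
        by (simp only: sum.swap[of _ _ "{1..m}"])
      also have "\<dots> = (\<Sum>i=1..k. \<Sum>y'=1..m'. \<Sum>x'=1..n'.
          \<alpha> i * R i (x, x') * W' (x', y') * L i x' y' * (\<Sum>y=1..m. T i (y', y)))"
        by (simp add: sum_distrib_left mult_ac)
      also have "\<dots> = (\<Sum>i=1..k. \<Sum>y'=1..m'. \<Sum>x'=1..n'. \<alpha> i * R i (x, x') * W' (x', y') * L i x' y')"
        using DMC_sum[OF T] by (intro sum.cong refl) simp
      finally show ?thesis .
    qed
    then show ?thesis by simp
  qed
  \<comment> \<open>With \<open>x\<close> innermost, \<open>p x\<close> and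
    \<open>R i (x, x')\<close> combine into \<open>P i x'\<close>.\<close>
  also have "\<dots> = (\<Sum>i=1..k. \<Sum>x'=1..n'. \<Sum>y'=1..m'. \<Sum>x=1..n.
      p x * (\<alpha> i * R i (x, x') * W' (x', y') * L i x' y'))"
  proof -
    have "(\<Sum>x=1..n. p x * (\<Sum>i=1..k. \<Sum>y'=1..m'. \<Sum>x'=1..n'.
        \<alpha> i * R i (x, x') * W' (x', y') * L i x' y')) =
      (\<Sum>x=1..n. \<Sum>i=1..k. \<Sum>x'=1..n'. \<Sum>y'=1..m'. p x * (\<alpha> i * R i (x, x') * W' (x', y') * L i x' y'))"
      unfolding sum_distrib_left by (intro sum.cong refl sum.swap)
    also have "\<dots> = (\<Sum>i=1..k. \<Sum>x'=1..n'. \<Sum>y'=1..m'. \<Sum>x=1..n.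
        p x * (\<alpha> i * R i (x, x') * W' (x', y') * L i x' y'))"
      by (simp only: sum.swap[of _ _ "{1..n}"])
    finally show ?thesis .
  qed
  also have "\<dots> = (\<Sum>i=1..k. \<alpha> i * (\<Sum>x'=1..n'. P i x' * (\<Sum>y'=1..m'. W' (x', y') * L i x' y')))"
    by (intro sum.cong refl)
      (simp add: P_def output_dist_def sum_distrib_left sum_distrib_right mult_ac)
  also have "\<dots> = (\<Sum>i=1..k. \<alpha> i * channel_information n' m' (P i) W')"
    using P W' by (intro sum.cong refl) (simp add: channel_information_divergence L_def Q_def)
  finally show ?thesis
    by (simp add: P_def)
qed

text \<open>An optimal input for \<open>W\<close>, pushed through each \<open>R i\<close>, is an
  admissible input for \<open>W'\<close>; the \<open>\<alpha>\<close>-average of the resulting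
  informations cannot exceed the capacity of \<open>W'\<close>.\<close>

lemma capacity_contains_mono:
  assumes cont: "channel_contains ((n', m'), W') ((n, m), W)"
    and n: "n \<ge> 1" "n' \<ge> 1" and W: "W \<in> DMC n m" and W': "W' \<in> DMC n' m'"
  shows "capacity ((n, m), W) \<le> capacity ((n', m'), W')"
proof -
  obtain k \<alpha> R T where \<alpha>: "\<alpha> \<in> prob_dists k" and R: "\<And>i. i \<in> {1..k} \<Longrightarrow> R i \<in> DMC n n'"
    and T: "\<And>i. i \<in> {1..k} \<Longrightarrow> T i \<in> DMC m' m"
    and WW': "\<And>x y. x \<in> {1..n} \<Longrightarrow> y \<in> {1..m} \<Longrightarrow> W (x, y) =
       (\<Sum>i=1..k. \<alpha> i * (\<Sum>y'=1..m'. T i (y', y) * (\<Sum>x'=1..n'. R i (x, x') * W' (x', y'))))"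
    by (rule channel_containsE[OF cont]) (rule that; assumption)
  obtain p where p: "p \<in> prob_dists n" "capacity ((n, m), W) = channel_information n m p W"
    using capacity_attained[OF n(1) W] by metis
  let ?C = "capacity ((n', m'), W')"
  have "capacity ((n, m), W) \<le>
      (\<Sum>i=1..k. \<alpha> i * channel_information n' m' (restrict (output_dist n p (R i)) {1..n'}) W')"
    unfolding p(2) by (rule channel_information_mixture_le[OF p(1) \<alpha> R T W' W WW'])
  also have "\<dots> \<le> (\<Sum>i=1..k. \<alpha> i * ?C)"
  proof (intro sum_mono mult_left_mono)
    fix i assume i: "i \<in> {1..k}"
    show "channel_information n' m' (restrict (output_dist n p (R i)) {1..n'}) W' \<le> ?C"
      using capacity_attained[OF n(2) W'] push_forward_prob_dists[OF p(1) R[OF i]] by metis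
    show "0 \<le> \<alpha> i" using prob_dists_nonneg[OF \<alpha> i] .
  qed
  also have "\<dots> = ?C"
    using prob_dists_sum[OF \<alpha>] by (simp flip: sum_distrib_right)
  finally show ?thesis .
qed

section \<open>Continuity on the space of equivalence classes\<close>

theorem proposition6:
  shows "continuous_map strong_topology (top_of_set {0..}) (class_value capacity) \<and>
    (\<forall>n\<ge>1. \<forall>M\<ge>1. continuous_map strong_topology (top_of_set {0..1}) (class_value (error_prob n M)))"
proof (intro conjI allI impI)
  show "continuous_map strong_topology (top_of_set {0..}) (class_value capacity)"
  proof (rule continuous_map_strong_topology)
    fix W W' assume "(W, W') \<in> shannon_equiv"
    \<comment> \<open>Equivalent channels contain each other, so monotonicity yields both
      inequalities.\<close>
    then show "capacity W = capacity W'"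
      by (cases W; cases W') (force simp: shannon_equiv_def mem_topspace_DMC_all
          simp del: capacity.simps channel_contains.simps intro: antisym capacity_contains_mono)
  qed (use continuous_on_capacity capacity_nonneg in auto)
  fix n M :: nat assume M: "M \<ge> 1"
  show "continuous_map strong_topology (top_of_set {0..1}) (class_value (error_prob n M))"
  proof (rule continuous_map_strong_topology)
    fix W W' assume "(W, W') \<in> shannon_equiv"
    then show "error_prob n M W = error_prob n M W'"
      using M by (cases W; cases W') (force simp: shannon_equiv_def mem_topspace_DMC_all
          simp del: error_prob.simps channel_contains.simps intro: antisym error_prob_contains_mono)
  qed (use M continuous_on_error_prob error_prob_bounds in auto)
qed

end
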